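(* Let $a_n = f_{213}(\mathrm{Av}_n(123))$ be the total number of occurrences of the pattern $213$ in all permutations in $\mathrm{Av}_n(123)$. Then, as formal power series over $\mathbb{Q}$, $$\sum_{n\geq 0} a_n x^n = \frac{x^3C(x)^3}{(1-4x)^{3/2}} = \frac{x-1}{2(1-4x)} - \frac{3x-1}{2(1-4x)^{3/2}}.$$
   Context: Permutations are written in one-line notation. For $p = p_1\cdots p_n \in S_n$ and $q = q_1 \cdots q_k\in S_k$, an occurrence of $q$ in $p$ (as a pattern) is a choice of indices $1 \le i_1 < \dots < i_k \le n$ such that $p_{i_1},\dots,p_{i_k}$ are in the same relative order as $q_1,\dots,q_k$ (i.e. $p_{i_s}<p_{i_t}$ iff $q_s<q_t$). $f_q(p)$ denotes the number of occurrences of $q$ in $p$, and $p$ avoids $q$ if $f_q(p)=0$. $\mathrm{Av}_n(r)$ is the set of permutations in $S_n$ avoiding $r$. For a finite set $\mathcal C$ of permutations, $f_q(\mathcal C)=\sum_{p\in\mathcal C} f_q(p)$. Also $C(x)=\sum_{n\ge 0} c_n x^n = \frac{1-\sqrt{1-4x}}{2x}$, where $c_n=\frac{1}{n+1}\binom{2n}{n}$. Powers $(1-4x)^{r}$ with $r$ a half-integer denote the binomial series with constant term $1$. *)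

theory Defs
  imports "HOL-Computational_Algebra.Formal_Power_Series"
          "HOL-Combinatorics.Multiset_Permutations"
begin

text \<open>
  A permutation in \<open>S\<^sub>n\<close> is given by its one-line notation, i.e. by a list in
  \<^term>\<open>permutations_of_set {1..n}\<close>. List positions start at \<open>0\<close>, so the index choice
  \<open>i\<^sub>1 < \<dots> < i\<^sub>k\<close> becomes a strictly increasing list of positions below \<open>n\<close>.
\<close>

definition occurrences :: "nat list \<Rightarrow> nat list \<Rightarrow> nat list set" where
  "occurrences q p =
     {is. length is = length q \<and> sorted_wrt (<) is \<and> set is \<subseteq> {..<length p} \<and>
          (\<forall>s<length q. \<forall>t<length q. p ! (is ! s) < p ! (is ! t) \<longleftrightarrow> q ! s < q ! t)}"

definition num_occ :: "nat list \<Rightarrow> nat list \<Rightarrow> nat" where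
  "num_occ q p = card (occurrences q p)"

definition avoids :: "nat list \<Rightarrow> nat list \<Rightarrow> bool" where
  "avoids p q \<longleftrightarrow> num_occ q p = 0"

definition Av :: "nat \<Rightarrow> nat list \<Rightarrow> nat list set" where
  "Av n r = {p \<in> permutations_of_set {1..n}. avoids p r}"

definition total_occ :: "nat list \<Rightarrow> nat list set \<Rightarrow> nat" where
  "total_occ q \<C> = (\<Sum>p\<in>\<C>. num_occ q p)"

text \<open>
  There are finitely many increasing lists of positions, so \<^const>\<open>card\<close> does not
  degenerate in \<^const>\<open>num_occ\<close>, nor does the sum over \<^const>\<open>Av\<close>.
\<close>

lemma finite_occurrences: "finite (occurrences q p)"
proof (rule finite_subset)
  show "occurrences q p \<subseteq> {is. set is \<subseteq> {..<length p} \<and> length is = length q}"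
    by (auto simp: occurrences_def)
  show "finite {is. set is \<subseteq> {..<length p} \<and> length is = length q}"
    by (rule finite_lists_length_eq) simp
qed

lemma finite_Av: "finite (Av n r)"
  by (simp add: Av_def)

definition catalan :: "nat \<Rightarrow> rat" where
  "catalan n = 1 / (of_nat n + 1) * of_nat ((2 * n) choose n)"

definition catalan_fps :: "rat fps" where
  "catalan_fps = Abs_fps catalan"

text \<open>
  The binomial series of \<open>(1 - 4x)\<^sup>r\<close>: \<^term>\<open>fps_binomial r\<close> is the series of \<open>(1 + x)\<^sup>r\<close>,
  into which \<open>-4x\<close> is substituted.
\<close>

definition one_minus_4X_powr :: "rat \<Rightarrow> rat fps" where
  "one_minus_4X_powr r = fps_binomial r oo (- 4 * fps_X)"

end

theory Submission
  imports Defs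
begin

text \<open>
  Let \<open>p\<close> avoid \<open>123\<close> and let \<open>d\<close> be the length of its initial decreasing run. A new maximum can be
  inserted after the first \<open>i\<close> entries without creating a \<open>123\<close> iff \<open>i \<le> d\<close>. This creates exactly
  \<open>i choose 2\<close> new occurrences of \<open>213\<close> (the first \<open>i\<close> entries are decreasing, and the maximum can
  only play the role of \<open>3\<close>), and the initial decreasing run becomes \<open>i\<close>, or \<open>d + 1\<close> if \<open>i = 0\<close>.
  This is the Catalan generating tree with weights, and its total weight has an explicit
  generating function in terms of \<open>C\<close>: at the root it is \<open>((C - 1) / (2 - C))\<^sup>3\<close>. With
  \<open>C - 1 = x C\<^sup>2\<close> and \<open>2 - C = C sqrt(1 - 4x)\<close> this is the claimed series.
\<close>

unbundle fps_syntax

subsection \<open>Inserting a new maximum\<close>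

text \<open>The map \<open>sh (length xs)\<close> leads positions of \<open>xs @ ys\<close> around
  the new entry. It is strictly increasing and keeps entries, so it carries occurrences in both
  directions.\<close>

lemma occurrences_avoiding_position:
  fixes m :: nat
  defines "sh \<equiv> (\<lambda>l j. if j < l then j else Suc j)"
  shows "{is \<in> occurrences q (xs @ m # ys). length xs \<notin> set is}
           = map (sh (length xs)) ` occurrences q (xs @ ys)"
proof -
  let ?l = "length xs" and ?p = "xs @ m # ys" and ?p' = "xs @ ys"
  \<comment> \<open>\<open>?g\<close> closes the gap again; away from position \<open>?l\<close> it
    inverts \<open>sh\<close>.\<close>
  let ?g = "\<lambda>j. if j < ?l then j else j - 1"
  have sh_nth: "?p ! sh ?l j = ?p' ! j" for j
    by (auto simp: sh_def nth_append Suc_diff_le)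
  have sh_g: "sh ?l (?g j) = j" if "j \<noteq> ?l" for j
    using that by (auto simp: sh_def)
  have sh_mono: "sh ?l a < sh ?l b \<longleftrightarrow> a < b" for a b
    by (auto simp: sh_def)
  have sh_len: "sh ?l j < length ?p \<longleftrightarrow> j < length ?p'" for j
    by (auto simp: sh_def)
  have sh_neq: "sh ?l j \<noteq> ?l" for j
    by (auto simp: sh_def)
  have key: "map (sh ?l) js \<in> occurrences q ?p \<longleftrightarrow> js \<in> occurrences q ?p'" for js
  proof -
    have "set (map (sh ?l) js) \<subseteq> {..<length ?p} \<longleftrightarrow> set js \<subseteq> {..<length ?p'}"
      using sh_len by (auto simp del: length_append)
    moreover have "sorted_wrt (<) (map (sh ?l) js) \<longleftrightarrow> sorted_wrt (<) js"
      by (simp add: sorted_wrt_map sh_mono)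
    ultimately show ?thesis
      unfolding occurrences_def by (auto simp: sh_nth simp del: length_append set_map)
  qed
  show ?thesis
  proof (intro set_eqI iffI)
    fix js assume a: "js \<in> {is \<in> occurrences q ?p. ?l \<notin> set is}"
    then have ne: "x \<noteq> ?l" if "x \<in> set js" for x
      using that by auto
    have "js = map (sh ?l) (map ?g js)"
      unfolding map_map by (rule sym, rule map_idI) (simp only: o_apply sh_g ne not_False_eq_True)
    with a key show "js \<in> map (sh ?l) ` occurrences q ?p'"
      by (metis (no_types, lifting) imageI mem_Collect_eq)
  next
    fix js assume "js \<in> map (sh ?l) ` occurrences q ?p'"
    then show "js \<in> {is \<in> occurrences q ?p. ?l \<notin> set is}"
      using key sh_neq by (auto; metis)
  qed
qed

lemma num_occ_insert:
  "num_occ q (xs @ m # ys) =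
     num_occ q (xs @ ys) + card {is \<in> occurrences q (xs @ m # ys). length xs \<in> set is}"
proof -
  let ?l = "length xs" and ?O = "occurrences q (xs @ m # ys)"
  have "?O = {is \<in> ?O. ?l \<notin> set is} \<union> {is \<in> ?O. ?l \<in> set is}"
    by auto
  then have "card ?O = card {is \<in> ?O. ?l \<notin> set is} + card {is \<in> ?O. ?l \<in> set is}"
    by (subst (1) \<open>?O = _\<close>, intro card_Un_disjoint) (auto simp: finite_occurrences)
  moreover have "inj (\<lambda>j. if j < ?l then j else Suc j)"
    by (auto simp: inj_def split: if_splits)
  then have "card {is \<in> ?O. ?l \<notin> set is} = card (occurrences q (xs @ ys))"
    unfolding occurrences_avoiding_position
    by (intro card_image) (simp add: inj_on_subset[OF inj_mapI])
  ultimately show ?thesis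
    by (simp add: num_occ_def)
qed

section \<open>Occurrences that use the inserted maximum\<close>

lemma nth_append_max_le:
  fixes m :: nat
  assumes "\<forall>y\<in>set xs \<union> set ys. y < m" "j < length (xs @ m # ys)"
  shows "(xs @ m # ys) ! j \<le> m"
  using nth_mem[OF assms(2)] assms(1) by (auto simp del: nth_mem intro: less_imp_le)

lemma length_3_conv: "length xs = 3 \<longleftrightarrow> (\<exists>a b c. xs = [a, b, c])"
  by (auto simp: numeral_3_eq_3 length_Suc_conv)

text \<open>The largest letter of either pattern stands last and no entry exceeds \<open>m\<close>,
  so an occurrence through the position of \<open>m\<close> must end there. What remains is a
  condition on a pair in \<open>xs\<close>.\<close>

lemma occurrences_through_max:
  assumes "\<forall>y\<in>set xs \<union> set ys. y < m"
    and q: "q = [1, 2, 3] \<or> q = [2, 1, 3]"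
  shows "{is \<in> occurrences q (xs @ m # ys). length xs \<in> set is}
           = {[a, b, length xs] | a b.
                a < b \<and> b < length xs \<and>
                (if q = [1, 2, 3] then xs ! a < xs ! b else xs ! b < xs ! a)}"
    (is "?L = ?R")
proof (intro set_eqI iffI)
  let ?p = "xs @ m # ys"
  have all3: "(\<forall>s<3. P s) \<longleftrightarrow> P 0 \<and> P 1 \<and> P (2::nat)" for P
    by (auto simp: numeral_3_eq_3 numeral_2_eq_2 less_Suc_eq)
  fix js assume js: "js \<in> ?L"
  have len: "length q = 3" using q by auto
  from js obtain a b c where abc: "js = [a, b, c]"
    by (auto simp: occurrences_def len length_3_conv)
  from js have *: "a < b" "b < c" "c < length ?p"
    and r: "\<forall>s<3. \<forall>t<3. ?p ! ([a,b,c] ! s) < ?p ! ([a,b,c] ! t) \<longleftrightarrow> q ! s < q ! t"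
    and l: "length xs \<in> {a, b, c}"
    by (auto simp: occurrences_def len abc)
  from r q have ac: "?p ! a < ?p ! c" and bc: "?p ! b < ?p ! c"
    and ab: "if q = [1, 2, 3] then ?p ! a < ?p ! b else ?p ! b < ?p ! a"
    by (auto simp: all3)
  have "?p ! c \<le> m" using nth_append_max_le[OF assms(1)] * by blast
  with ac bc have "a \<noteq> length xs" "b \<noteq> length xs" by auto
  with l have c: "c = length xs" by auto
  with ab * show "js \<in> ?R"
    by (auto simp: abc nth_append)
next
  have all3: "(\<forall>s<3. P s) \<longleftrightarrow> P 0 \<and> P 1 \<and> P (2::nat)" for P
    by (auto simp: numeral_3_eq_3 numeral_2_eq_2 less_Suc_eq)
  have len: "length q = 3" using q by auto
  fix js assume "js \<in> ?R"
  then obtain a b where js: "js = [a, b, length xs]" "a < b" "b < length xs"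
    "if q = [1, 2, 3] then xs ! a < xs ! b else xs ! b < xs ! a"
    by blast
  moreover from js assms(1) have "xs ! a < m" "xs ! b < m" by auto
  ultimately show "js \<in> ?L"
    using q unfolding occurrences_def len all3 by (auto simp: nth_append)
qed

lemma avoids_123_insert_max:
  fixes m :: nat
  assumes "\<forall>y\<in>set xs \<union> set ys. y < m" "distinct xs"
  shows "avoids (xs @ m # ys) [1, 2, 3] \<longleftrightarrow>
           avoids (xs @ ys) [1, 2, 3] \<and> sorted_wrt (>) xs"
proof -
  let ?S = "{is \<in> occurrences [1, 2, 3] (xs @ m # ys). length xs \<in> set is}"
  have S: "?S = {[a, b, length xs] | a b. a < b \<and> b < length xs \<and> xs ! a < xs ! b}"
    by (subst occurrences_through_max[OF assms(1)]) (simp_all only: if_True simp_thms)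
  have "?S = {} \<longleftrightarrow> (\<forall>b<length xs. \<forall>a<b. \<not> xs ! a < xs ! b)"
    unfolding S by blast
  moreover have "(\<forall>b<length xs. \<forall>a<b. \<not> xs ! a < xs ! b) \<longleftrightarrow> sorted_wrt (>) xs"
  proof -
    have "\<not> xs ! a < xs ! b \<longleftrightarrow> xs ! b < xs ! a" if "a < b" "b < length xs" for a b
    proof -
      have "xs ! a \<noteq> xs ! b" using assms(2) that by (simp add: nth_eq_iff_index_eq)
      then show ?thesis by auto
    qed
    then show ?thesis unfolding sorted_wrt_iff_nth_less by blast
  qed
  moreover have "card ?S = 0 \<longleftrightarrow> ?S = {}"
    by (simp add: finite_occurrences)
  ultimately show ?thesis
    unfolding avoids_def num_occ_insert[of _ xs] by simp
qed

lemma card_pairs_less: "card {(a, b). a < b \<and> b < (l::nat)} = l choose 2"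
proof -
  have "{(a, b). a < b \<and> b < l} = prod.swap ` (SIGMA b:{..<l}. {..<b})"
    by (auto simp: image_iff)
  then have "card {(a, b). a < b \<and> b < l} = card (SIGMA b:{..<l}. {..<b})"
    by (simp add: card_image)
  also have "\<dots> = \<Sum>{..<l}" by simp
  also have "\<dots> = l choose 2"
    by (induction l) (auto simp: numeral_2_eq_2)
  finally show ?thesis .
qed

lemma num_occ_213_insert_max:
  fixes m :: nat
  assumes "\<forall>y\<in>set xs \<union> set ys. y < m" "sorted_wrt (>) xs"
  shows "num_occ [2, 1, 3] (xs @ m # ys) = num_occ [2, 1, 3] (xs @ ys) + (length xs choose 2)"
proof -
  let ?l = "length xs"
  have d: "xs ! b < xs ! a" if "a < b" "b < ?l" for a b
    using assms(2) that by (simp add: sorted_wrt_iff_nth_less)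
  have "{is \<in> occurrences [2, 1, 3] (xs @ m # ys). ?l \<in> set is}
          = (\<lambda>(a, b). [a, b, ?l]) ` {(a, b). a < b \<and> b < ?l}"
    using d by (subst occurrences_through_max[OF assms(1)]) auto
  then have "card {is \<in> occurrences [2, 1, 3] (xs @ m # ys). ?l \<in> set is} = ?l choose 2"
    by (simp add: card_image inj_on_def card_pairs_less)
  then show ?thesis by (simp add: num_occ_insert[of _ xs])
qed

subsection \<open>The generating tree of \<open>123\<close>-avoiding permutations\<close>

fun desc_run :: "nat list \<Rightarrow> nat" where
  "desc_run [] = 0"
| "desc_run [x] = 1"
| "desc_run (x # y # zs) = (if x > y then Suc (desc_run (y # zs)) else 1)"

lemma desc_run_le_length: "desc_run p \<le> length p"
  by (induction p rule: desc_run.induct) auto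

text \<open>Turns the prefix condition of \<open>avoids_123_insert_max\<close> into an interval of
  admissible sites, so that \<open>desc_run p\<close> alone can label a node.\<close>

lemma sorted_take_iff_desc_run:
  "i \<le> length p \<Longrightarrow> sorted_wrt (>) (take i p) \<longleftrightarrow> i \<le> desc_run p"
proof (induction p arbitrary: i rule: desc_run.induct)
  case (2 x)
  then show ?case by (cases i) auto
next
  case (3 x y zs)
  consider "i \<le> 1" | k where "i = Suc (Suc k)"
    by (metis One_nat_def Suc_le_mono le_0_eq not0_implies_Suc nat_le_linear)
  then show ?case
  proof cases
    case 1
    then show ?thesis by (cases i) auto
  next
    case 2
    have "sorted_wrt (>) (x # y # take k zs) \<longleftrightarrow> x > y \<and> sorted_wrt (>) (y # take k zs)"
      by auto
    with 2 3 show ?thesis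
      by (cases "x > y") (auto simp del: sorted_wrt.simps dest: "3.IH"[of "Suc k"])
  qed
qed auto

lemma desc_run_Cons_max: "\<forall>y\<in>set p. y < m \<Longrightarrow> desc_run (m # p) = Suc (desc_run p)"
  by (cases p) auto

text \<open>The step from the last entry of \<open>xs\<close> up to \<open>m\<close> is an ascent
  and ends the run. With an empty prefix the maximum would lengthen the run instead.\<close>

lemma desc_run_insert_max:
  "\<forall>y\<in>set xs. y < m \<Longrightarrow> sorted_wrt (>) xs \<Longrightarrow> xs \<noteq> [] \<Longrightarrow>
     desc_run (xs @ m # ys) = length xs"
proof (induction xs)
  case (Cons x xs)
  then show ?case by (cases xs) auto
qed simp

section \<open>Children of a 123-avoiding permutation\<close>

definition insert_at :: "'a \<Rightarrow> nat \<Rightarrow> 'a list \<Rightarrow> 'a list" where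
  "insert_at m i p = take i p @ m # drop i p"

lemma Av_iff: "p \<in> Av n r \<longleftrightarrow> set p = {1..n} \<and> distinct p \<and> avoids p r"
  by (auto simp: Av_def permutations_of_set_def)

text \<open>Deleting the maximum inverts the insertion; by \<open>avoids_123_insert_max\<close> what
  is left avoids 123 and the entries before the maximum were decreasing.\<close>

lemma bij_betw_insert_max_Av:
  "bij_betw (\<lambda>(p, i). insert_at (Suc n) i p)
     (SIGMA p:Av n [1, 2, 3]. {..desc_run p}) (Av (Suc n) [1, 2, 3])"
proof (rule bij_betw_imageI)
  let ?F = "\<lambda>(p, i). insert_at (Suc n) i p"
  let ?S = "SIGMA p:Av n [1, 2, 3]. {..desc_run p}"
  show "inj_on ?F ?S"
  proof (rule inj_onI)
    fix a b assume ab: "a \<in> ?S" "b \<in> ?S" "?F a = ?F b"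
    obtain p i p' i' where a: "a = (p, i)" and b: "b = (p', i')"
      by (cases a, cases b)
    from ab have p: "p \<in> Av n [1, 2, 3]" "i \<le> desc_run p"
      and p': "p' \<in> Av n [1, 2, 3]" "i' \<le> desc_run p'"
      and eq: "insert_at (Suc n) i p = insert_at (Suc n) i' p'"
      by (auto simp: a b)
    have "Suc n \<notin> set p" "Suc n \<notin> set p'"
      using p p' by (auto simp: Av_iff)
    then have "Suc n \<notin> set (take i p)" "Suc n \<notin> set (take i' p')"
      "Suc n \<notin> set (drop i p)" "Suc n \<notin> set (drop i' p')"
      by (meson in_set_takeD in_set_dropD)+
    \<comment> \<open>As \<open>Suc n\<close> occurs in none of the four pieces, its place in the
      common result fixes prefix and suffix.\<close>
    with eq have td: "take i p = take i' p'" "drop i p = drop i' p'"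
      by (auto simp: insert_at_def append_Cons_eq_iff)
    moreover have "i \<le> length p" "i' \<le> length p'"
      using p(2) p'(2) desc_run_le_length[of p] desc_run_le_length[of p'] by auto
    ultimately show "a = b"
      unfolding a b by (metis append_take_drop_id length_take min.absorb2)
  qed
  show "?F ` ?S = Av (Suc n) [1, 2, 3]"
  proof (intro set_eqI iffI)
    fix r assume "r \<in> ?F ` ?S"
    then obtain p i where r: "r = insert_at (Suc n) i p"
      and p: "p \<in> Av n [1, 2, 3]" and i: "i \<le> desc_run p" by auto
    have le: "i \<le> length p" using i desc_run_le_length le_trans by blast
    have pp: "set p = {1..n}" "distinct p" "avoids p [1, 2, 3]"
      using p by (auto simp: Av_iff)
    have un: "set (take i p) \<union> set (drop i p) = {1..n}"
      by (metis append_take_drop_id pp(1) set_append)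
    then have mx: "\<forall>y\<in>set (take i p) \<union> set (drop i p). y < Suc n" by auto
    have "set r = {1..Suc n}"
      using un by (auto simp: r insert_at_def)
    moreover have "distinct r"
      using pp(2) mx by (auto simp: r insert_at_def set_take_disj_set_drop_if_distinct)
    moreover have "avoids r [1, 2, 3]"
      using avoids_123_insert_max[OF mx] pp sorted_take_iff_desc_run[OF le] i
      by (simp add: r insert_at_def)
    ultimately show "r \<in> Av (Suc n) [1, 2, 3]" by (simp add: Av_iff)
  next
    fix r assume "r \<in> Av (Suc n) [1, 2, 3]"
    then have r: "set r = {1..Suc n}" "distinct r" "avoids r [1, 2, 3]"
      by (auto simp: Av_iff)
    then have "Suc n \<in> set r" by auto
    then obtain xs ys where xy: "r = xs @ Suc n # ys"
      by (auto dest: split_list)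
    have un: "set xs \<union> set ys = {1..n}"
    proof -
      have "set xs \<union> set ys = set r - {Suc n}" using r(2) by (auto simp: xy)
      then show ?thesis using r(1) by auto
    qed
    then have mx: "\<forall>y\<in>set xs \<union> set ys. y < Suc n" by auto
    have av: "avoids (xs @ ys) [1, 2, 3]" "sorted_wrt (>) xs"
      using avoids_123_insert_max[OF mx] r by (auto simp: xy)
    have "xs @ ys \<in> Av n [1, 2, 3]"
      using av un r(2) by (auto simp: Av_iff xy)
    moreover have "length xs \<le> desc_run (xs @ ys)"
      using sorted_take_iff_desc_run[of "length xs" "xs @ ys"] av by simp
    moreover have "r = insert_at (Suc n) (length xs) (xs @ ys)"
      by (simp add: insert_at_def xy)
    ultimately show "r \<in> ?F ` ?S"
      by (force intro!: image_eqI[of _ _ "(xs @ ys, length xs)"])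
  qed
qed

lemma desc_run_insert_at:
  assumes "p \<in> Av n [1, 2, 3]" "i \<le> desc_run p"
  shows "desc_run (insert_at (Suc n) i p) = (if i = 0 then Suc (desc_run p) else i)"
    and "num_occ [2, 1, 3] (insert_at (Suc n) i p) = num_occ [2, 1, 3] p + (i choose 2)"
proof -
  have le: "i \<le> length p" using assms desc_run_le_length le_trans by blast
  have p: "set p = {1..n}" using assms by (auto simp: Av_iff)
  have s: "sorted_wrt (>) (take i p)"
    using sorted_take_iff_desc_run[OF le] assms by simp
  have mx: "\<forall>y\<in>set (take i p) \<union> set (drop i p). y < Suc n"
    using p by (auto dest!: in_set_takeD in_set_dropD)
  show "num_occ [2, 1, 3] (insert_at (Suc n) i p) = num_occ [2, 1, 3] p + (i choose 2)"
    using num_occ_213_insert_max[OF mx s] le by (simp add: insert_at_def)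
  show "desc_run (insert_at (Suc n) i p) = (if i = 0 then Suc (desc_run p) else i)"
  proof (cases "i = 0")
    case True
    then show ?thesis using p by (simp add: insert_at_def desc_run_Cons_max)
  next
    case False
    then have "take i p \<noteq> []" using le by auto
    then show ?thesis
      using desc_run_insert_max[of "take i p" "Suc n" "drop i p"] s mx le False
      by (simp add: insert_at_def)
  qed
qed

section \<open>Weighted sums over the levels of the tree\<close>

lemma sum_Av_Suc:
  fixes g :: "nat \<Rightarrow> nat \<Rightarrow> nat"
  shows "(\<Sum>p\<in>Av (Suc n) [1, 2, 3]. g (desc_run p) (num_occ [2, 1, 3] p)) =
    (\<Sum>p\<in>Av n [1, 2, 3]. g (Suc (desc_run p)) (num_occ [2, 1, 3] p)
       + (\<Sum>i=1..desc_run p. g i (num_occ [2, 1, 3] p + (i choose 2))))"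
proof -
  have "(\<Sum>p\<in>Av (Suc n) [1, 2, 3]. g (desc_run p) (num_occ [2, 1, 3] p)) =
     (\<Sum>(p, i)\<in>(SIGMA p:Av n [1, 2, 3]. {..desc_run p}).
        g (if i = 0 then Suc (desc_run p) else i) (num_occ [2, 1, 3] p + (i choose 2)))"
    by (subst sum.reindex_bij_betw[OF bij_betw_insert_max_Av, symmetric], rule sum.cong)
       (auto simp: desc_run_insert_at simp del: One_nat_def)
  also have "\<dots> = (\<Sum>p\<in>Av n [1, 2, 3]. \<Sum>i\<le>desc_run p.
        g (if i = 0 then Suc (desc_run p) else i) (num_occ [2, 1, 3] p + (i choose 2)))"
    by (subst sum.Sigma) (auto simp: finite_Av)
  also have "\<dots> = (\<Sum>p\<in>Av n [1, 2, 3]. g (Suc (desc_run p)) (num_occ [2, 1, 3] p)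
       + (\<Sum>i=1..desc_run p. g i (num_occ [2, 1, 3] p + (i choose 2))))"
    \<comment> \<open>Site 0 is split off because it alone has label \<open>d + 1\<close>; its gain
      \<open>0 choose 2\<close> vanishes.\<close>
    by (intro sum.cong refl) (simp add: atMost_atLeast0 sum.atLeast_Suc_atMost binomial_eq_0)
  finally show ?thesis .
qed

text \<open>
  For a node whose label (the length of its initial decreasing run) is \<open>d\<close>, the number of its
  descendants \<open>k\<close> levels below, and the total number of \<open>213\<close>'s these have gained.
\<close>

fun descendants :: "nat \<Rightarrow> nat \<Rightarrow> nat" where
  "descendants 0 d = 1"
| "descendants (Suc k) d = descendants k (Suc d) + (\<Sum>i=1..d. descendants k i)"

fun gained :: "nat \<Rightarrow> nat \<Rightarrow> nat" where
  "gained 0 d = 0"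
| "gained (Suc k) d =
     gained k (Suc d) + (\<Sum>i=1..d. gained k i + (i choose 2) * descendants k i)"

text \<open>An occurrence in a node persists in all its descendants, hence the factor
  \<open>descendants k (desc_run p)\<close>. The induction passes from level \<open>n\<close> to
  level \<open>n + 1\<close>, so \<open>n\<close> must be arbitrary.\<close>

lemma total_occ_descend:
  "total_occ [2, 1, 3] (Av (n + k) [1, 2, 3]) =
     (\<Sum>p\<in>Av n [1, 2, 3]. num_occ [2, 1, 3] p * descendants k (desc_run p) + gained k (desc_run p))"
proof (induction k arbitrary: n)
  case 0
  then show ?case by (simp add: total_occ_def)
next
  case (Suc k)
  have "total_occ [2, 1, 3] (Av (n + Suc k) [1, 2, 3]) =
    (\<Sum>p\<in>Av (Suc n) [1, 2, 3].
       num_occ [2, 1, 3] p * descendants k (desc_run p) + gained k (desc_run p))"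
    using Suc.IH[of "Suc n"] by simp
  also have "\<dots> = (\<Sum>p\<in>Av n [1, 2, 3].
     num_occ [2, 1, 3] p * descendants (Suc k) (desc_run p) + gained (Suc k) (desc_run p))"
    by (subst sum_Av_Suc[of "\<lambda>d f. f * descendants k d + gained k d"])
       (intro sum.cong refl,
        simp add: algebra_simps sum.distrib sum_distrib_left sum_distrib_right)
  finally show ?case .
qed

lemma total_occ_Av: "total_occ [2, 1, 3] (Av n [1, 2, 3]) = gained n 0"
proof -
  have "Av 0 [1, 2, 3] = {[]}"
    by (auto simp: Av_iff avoids_def num_occ_def occurrences_def)
  moreover have "num_occ [2, 1, 3] [] = 0"
    by (auto simp: num_occ_def occurrences_def)
  ultimately show ?thesis using total_occ_descend[of 0 n] by simp
qed

subsection \<open>Generating functions\<close>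

abbreviation sqrt_fps :: "rat fps" where
  "sqrt_fps \<equiv> one_minus_4X_powr (1 / 2)"

lemma one_minus_4X_powr_add:
  "one_minus_4X_powr (a + b) = one_minus_4X_powr a * one_minus_4X_powr b"
proof -
  have "(- 4 * fps_X :: rat fps) $ 0 = 0" by simp
  then show ?thesis
    unfolding one_minus_4X_powr_def fps_binomial_add_mult
    by (rule fps_compose_mult_distrib)
qed

lemma fps_neg4_X: "(- 4 * fps_X :: rat fps) = fps_const (- 4) * fps_X"
  by (simp add: fps_const_neg[symmetric] numeral_fps_const del: fps_const_neg)

lemma sqrt_fps_square: "sqrt_fps ^ 2 = 1 - 4 * fps_X"
proof -
  have "sqrt_fps ^ 2 = one_minus_4X_powr 1"
    using one_minus_4X_powr_add[of "1/2" "1/2"] by (simp add: power2_eq_square)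
  also have "\<dots> = 1 - 4 * fps_X"
    by (simp add: one_minus_4X_powr_def fps_binomial_1 fps_compose_add_distrib)
  finally show ?thesis .
qed

lemma one_minus_4X_powr_three_halves: "one_minus_4X_powr (3 / 2) = sqrt_fps ^ 3"
  using one_minus_4X_powr_add[of "1/2" "1/2"] one_minus_4X_powr_add[of 1 "1/2"]
  by (simp add: power3_eq_cube)

lemma catalan_Suc: "catalan (Suc n) * of_nat (n + 2) = of_nat (4 * n + 2) * catalan n"
proof -
  have "(2 * Suc n choose Suc n) * Suc n = 2 * (2 * n + 1) * (2 * n choose n)"
  proof -
    have "Suc n * (2 * Suc n choose Suc n) = (2 * n + 2) * (Suc (2 * n) choose n)"
      using Suc_times_binomial[of n "Suc (2 * n)"] by simp
    moreover have "Suc n * (Suc (2 * n) choose n) = Suc (2 * n) * (2 * n choose n)"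
      using Suc_times_binomial_add[of n n] Suc_times_binomial[of n "2 * n"]
        binomial_symmetric[of n "Suc (2*n)"]
      by (simp add: mult_2)
    \<comment> \<open>Each of the two identities brings a factor \<open>Suc n\<close>; one of them
      is cancelled afterwards.\<close>
    ultimately have "Suc n * (Suc n * (2 * Suc n choose Suc n))
        = Suc n * (2 * (2 * n + 1) * (2 * n choose n))"
      by (simp add: algebra_simps)
    then show ?thesis by (simp only: mult_cancel1 mult.commute) auto
  qed
  then have "(of_nat (2 * Suc n choose Suc n) :: rat) * of_nat (Suc n) =
      of_nat (2 * (2 * n + 1)) * of_nat (2 * n choose n)"
    by (metis of_nat_mult)
  then show ?thesis
    by (simp add: catalan_def field_simps del: binomial_Suc_Suc)
qed

text \<open>Both sides satisfy \<open>(n + 2) * a (n + 1) = (4 * n + 2) * a n\<close> and start at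
  -2.\<close>

lemma sqrt_fps_nth_Suc: "sqrt_fps $ Suc n = - 2 * catalan n"
proof -
  have c: "sqrt_fps $ k = (- 4) ^ k * ((1 / 2) gchoose k)" for k
    unfolding one_minus_4X_powr_def fps_neg4_X fps_compose_linear by simp
  show ?thesis
  proof (induction n)
    case 0
    then show ?case by (simp add: c catalan_def)
  next
    case (Suc n)
    \<comment> \<open>Absorption with upper index 1/2; the additional factor -4 turns
      \<open>1/2 - (n + 1)\<close> into \<open>4 * n + 2\<close>.\<close>
    have R: "of_nat (n + 2) * ((1 / 2 :: rat) gchoose Suc (Suc n))
            = (1 / 2 - of_nat (Suc n)) * ((1 / 2) gchoose Suc n)"
      using gbinomial_absorb_comp[of "1/2::rat" "Suc n"] gbinomial_absorption[of "Suc n" "1/2::rat"]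
      by (simp add: algebra_simps)
    have "of_nat (n + 2) * sqrt_fps $ Suc (Suc n)
            = (- 4) ^ Suc (Suc n) * (of_nat (n + 2) * ((1 / 2) gchoose Suc (Suc n)))"
      unfolding c by (simp only: mult_ac)
    also have "\<dots> = of_nat (4 * n + 2) * sqrt_fps $ Suc n"
      unfolding R c by (simp add: algebra_simps)
    also have "\<dots> = of_nat (n + 2) * (- 2 * catalan (Suc n))"
      using catalan_Suc[of n] by (simp only: Suc.IH) (simp add: algebra_simps)
    finally show ?case by (simp only: mult_cancel_left) auto
  qed
qed

lemma sqrt_fps_catalan: "sqrt_fps = 1 - 2 * fps_X * catalan_fps"
proof (rule fps_ext)
  fix n
  have "sqrt_fps $ 0 = 1"
    by (simp add: one_minus_4X_powr_def)
  then show "sqrt_fps $ n = (1 - 2 * fps_X * catalan_fps) $ n"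
    by (cases n) (auto simp: sqrt_fps_nth_Suc catalan_fps_def mult.assoc numeral_fps_const)
qed

text \<open>Squaring \<open>sqrt_fps_catalan\<close> gives \<open>1 - 4x\<close>; cancelling
  \<open>4x\<close> leaves this equation, with no convolution of Catalan numbers.\<close>

lemma catalan_fps_quadratic: "fps_X * catalan_fps ^ 2 = catalan_fps - 1"
proof -
  have "(1 - 2 * fps_X * catalan_fps) ^ 2 = 1 - 4 * (fps_X :: rat fps)"
    using sqrt_fps_square unfolding sqrt_fps_catalan .
  then have "(4 * fps_X) * (fps_X * catalan_fps ^ 2) = (4 * fps_X) * (catalan_fps - 1)"
    by (simp add: power2_eq_square algebra_simps)
  then show ?thesis by (simp only: mult_cancel_left) auto
qed

section \<open>Series counting the descendants and their gained occurrences\<close>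

lemma descendants_gf: "(catalan_fps ^ Suc d) $ k = of_nat (descendants k d)"
proof -
  define C where "C = catalan_fps"
  have quad: "fps_X * C ^ 2 = C - 1"
    unfolding C_def by (rule catalan_fps_quadratic)
  \<comment> \<open>This is the recursion of \<open>descendants\<close> in series form, the 1 being
    the node itself. Raising \<open>d\<close> uses \<open>C = 1 + x C^2\<close>.\<close>
  have rec: "C ^ Suc d = 1 + fps_X * (C ^ (d + 2) + (\<Sum>i=1..d. C ^ Suc i))" for d
  proof (induction d)
    case 0
    then show ?case using quad by (simp add: power2_eq_square)
  next
    case (Suc d)
    have "C ^ Suc (Suc d) = C ^ Suc d + C ^ Suc d * (fps_X * C ^ 2)"
      unfolding quad by (simp add: algebra_simps)
    also have "\<dots> = 1 + fps_X * (C ^ (d + 2) + (\<Sum>i=1..d. C ^ Suc i))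
        + fps_X * C ^ (Suc d + 2)"
      by (subst (1) Suc) (simp add: algebra_simps power2_eq_square)
    also have "\<dots> = 1 + fps_X * (C ^ (Suc d + 2) + (\<Sum>i=1..Suc d. C ^ Suc i))"
      by (simp add: algebra_simps)
    finally show ?case .
  qed
  \<comment> \<open>The factor \<open>fps_X\<close> in \<open>rec\<close> reduces coefficient
    \<open>k + 1\<close> to coefficients \<open>k\<close>, but for other labels, so the claim ranges
    over all \<open>d\<close>.\<close>
  have "\<forall>d. (C ^ Suc d) $ k = of_nat (descendants k d)"
  proof (induction k)
    case 0
    have "C $ 0 = 1" by (simp add: C_def catalan_fps_def catalan_def)
    then show ?case by (simp add: fps_power_zeroth del: power_Suc)
  next
    case (Suc k)
    show ?case
      by (subst rec) (simp add: fps_sum_nth Suc Suc[rule_format, of "Suc _", simplified] del: power_Suc)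
  qed
  then show ?thesis by (simp add: C_def)
qed

text \<open>
  With \<open>u = C - 1 = x C\<^sup>2\<close>, the series \<open>G\<^sub>d\<close> of \<^const>\<open>gained\<close> satisfies
  \<open>x G\<^bsub>d+1\<^esub> - G\<^sub>d + G\<^bsub>d-1\<^esub> = - x (d choose 2) C\<^bsup>d+1\<^esup>\<close> and \<open>G\<^sub>0 = x G\<^sub>1\<close>.
  Since \<open>C\<close> is a root of \<open>x t\<^sup>2 - t + 1\<close>, the solution is \<open>C\<^sup>d\<close> times a cubic polynomial in \<open>d\<close>.
\<close>

lemma gained_gf:
  fixes u w :: "rat fps"
  defines "u \<equiv> catalan_fps - 1" and "w \<equiv> inverse (2 - catalan_fps)"
  shows "(catalan_fps ^ d * (u ^ 3 * w ^ 3 + u ^ 2 * w ^ 3 * of_nat d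
            + u * w ^ 2 * of_nat (d choose 2) + u * w * of_nat (d choose 3))) $ k
         = of_nat (gained k d)"
proof -
  define C where "C = catalan_fps"
  define P where "P d = u ^ 3 * w ^ 3 + u ^ 2 * w ^ 3 * of_nat d
            + u * w ^ 2 * of_nat (d choose 2) + u * w * of_nat (d choose 3)" for d
  have C: "C = 1 + u" by (simp add: C_def u_def)
  have quad: "fps_X * C ^ 2 = u"
    unfolding C_def u_def by (rule catalan_fps_quadratic)
  have "(2 - catalan_fps) $ 0 \<noteq> 0"
    by (simp add: catalan_fps_def catalan_def)
  then have "w * (2 - catalan_fps) = 1"
    unfolding w_def by (rule inverse_mult_eq_1)
  then have w: "w = 1 + u * w" by (simp add: u_def algebra_simps)
  \<comment> \<open>\<open>D\<close> is the first difference of the cubic \<open>P\<close>: in the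
    binomial basis, Pascal's rule just shifts the coefficients.\<close>
  define D where "D d = u ^ 2 * w ^ 3 + u * w ^ 2 * of_nat d + u * w * of_nat (d choose 2)" for d
  have P_Suc: "P (Suc d) = P d + D d" for d
    by (simp add: P_def D_def numeral_2_eq_2 numeral_3_eq_3 algebra_simps)
  \<comment> \<open>Comparing coefficients of \<open>d choose 2\<close>, \<open>d\<close> and 1, in
    this order, determines those of \<open>D\<close>; each comparison uses
    \<open>w = 1 + u w\<close>, that is \<open>w = 1 / (1 - u)\<close>.\<close>
  have D_Suc: "D d = u * D (Suc d) + u * of_nat (Suc d choose 2)" for d
  proof -
    have S: "of_nat (Suc d choose 2) = (of_nat d + of_nat (d choose 2) :: rat fps)"
      by (simp add: numeral_2_eq_2)
    have "u * w = u * (1 + u * w)" "u * w ^ 2 = u * w * (1 + u * w)"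
      "u ^ 2 * w ^ 3 = u ^ 2 * w ^ 2 * (1 + u * w)"
      unfolding w[symmetric] by (simp_all add: power2_eq_square power3_eq_cube)
    then have e: "u + u * (u * w) = u * w" "u * w + u * (u * w ^ 2) = u * w ^ 2"
      "u * (u * w ^ 2) + u * (u ^ 2 * w ^ 3) = u ^ 2 * w ^ 3"
      by (simp_all add: power2_eq_square power3_eq_cube algebra_simps)
    have "D d = (u * (u * w ^ 2) + u * (u ^ 2 * w ^ 3))
        + ((u + u * (u * w)) + u * (u * w ^ 2)) * of_nat d
        + (u + u * (u * w)) * of_nat (d choose 2)"
      by (simp only: e D_def)
    also have "\<dots> = u * D (Suc d) + u * of_nat (Suc d choose 2)"
      unfolding D_def S of_nat_Suc by (simp add: algebra_simps)
    finally show ?thesis .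
  qed
  \<comment> \<open>The three-term recurrence for \<open>C^d * P d\<close>, taken at
    \<open>d + 1\<close> and divided by \<open>C^d\<close>, with \<open>x C^2 = u\<close>.\<close>
  have step: "C * P (Suc d) - P d = u * P (Suc (Suc d)) + u * of_nat (Suc d choose 2)" for d
  proof -
    have "C * P (Suc d) - P d = u * P (Suc d) + D d"
      by (simp add: C P_Suc algebra_simps)
    also have "\<dots> = u * P (Suc d) + (u * D (Suc d) + u * of_nat (Suc d choose 2))"
      by (simp only: D_Suc[of d])
    also have "\<dots> = u * P (Suc (Suc d)) + u * of_nat (Suc d choose 2)"
      by (simp add: P_Suc[of "Suc d"] algebra_simps del: binomial_Suc_Suc)
    finally show ?thesis .
  qed
  have rec: "C ^ d * P d = fps_X * (C ^ Suc d * P (Suc d)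
               + (\<Sum>i=1..d. C ^ i * P i + of_nat (i choose 2) * C ^ Suc i))" for d
  proof (induction d)
    case 0
    \<comment> \<open>The condition at the root fixes the constant term \<open>u^3 w^3\<close> of
      the cubic.\<close>
    have "P 0 = fps_X * (C * P 1)"
    proof -
      have "P 1 = C * (u ^ 2 * w ^ 3)"
        by (simp add: P_def C binomial_eq_0 power2_eq_square power3_eq_cube algebra_simps)
      then have P1: "fps_X * (C * P 1) = (fps_X * C ^ 2) * (u ^ 2 * w ^ 3)"
        by (simp only: power2_eq_square mult_ac)
      have P0: "P 0 = u * (u ^ 2 * w ^ 3)"
        by (simp add: P_def binomial_eq_0 power2_eq_square power3_eq_cube)
      show ?thesis unfolding P1 P0 quad ..
    qed
    then show ?case by simp
  next
    case (Suc d)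
    have "C ^ Suc d * P (Suc d) = C ^ d * P d + C ^ d * (C * P (Suc d) - P d)"
      by (simp add: algebra_simps)
    also have "\<dots> = C ^ d * P d + C ^ d * ((fps_X * C ^ 2) * P (Suc (Suc d))
        + (fps_X * C ^ 2) * of_nat (Suc d choose 2))"
      unfolding step quad ..
    also have "\<dots> = fps_X * (C ^ Suc (Suc d) * P (Suc (Suc d))
        + (\<Sum>i=1..Suc d. C ^ i * P i + of_nat (i choose 2) * C ^ Suc i))"
      by (subst Suc) (simp add: algebra_simps power2_eq_square del: binomial_Suc_Suc)
    finally show ?case .
  qed
  have "\<forall>d. (C ^ d * P d) $ k = of_nat (gained k d)"
  proof (induction k)
    case 0
    show ?case by (subst rec) simp
  next
    case (Suc k)
    have nat_nth: "((of_nat m :: rat fps) * f) $ j = of_nat m * f $ j" for m f j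
      by (simp add: fps_of_nat[symmetric])
    show ?case
      by (subst rec)
         (simp add: fps_sum_nth nat_nth Suc[rule_format] descendants_gf C_def[symmetric] 
           descendants_gf[folded C_def] del: power_Suc)
  qed
  then show ?thesis by (simp add: C_def P_def)
qed

theorem theorem19:
  shows "Abs_fps (\<lambda>n. of_nat (total_occ [2, 1, 3] (Av n [1, 2, 3])) :: rat)
           = fps_X ^ 3 * catalan_fps ^ 3 / one_minus_4X_powr (3 / 2) \<and>
         fps_X ^ 3 * catalan_fps ^ 3 / one_minus_4X_powr (3 / 2)
           = (fps_X - 1) / (2 * (1 - 4 * fps_X))
             - (3 * fps_X - 1) / (2 * one_minus_4X_powr (3 / 2))"
proof -
  define u w s where "u = catalan_fps - 1" "w = inverse (2 - catalan_fps)" "s = sqrt_fps"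
  have u: "u = fps_X * catalan_fps ^ 2"
    by (simp add: u_w_s_def catalan_fps_quadratic)
  have s: "s = 1 - 2 * fps_X * catalan_fps" "s ^ 2 = 1 - 4 * fps_X"
    by (simp_all only: u_w_s_def sqrt_fps_catalan[symmetric] sqrt_fps_square)
  have s0: "s $ 0 = 1" by (simp add: s(1))
  then have sv: "inverse s * s = 1" by (intro inverse_mult_eq_1) simp
  have nz: "s ^ k \<noteq> 0" for k using s0 by auto
  have "(2 - catalan_fps) $ 0 \<noteq> 0"
    by (simp add: catalan_fps_def catalan_def)
  then have "w * (2 - catalan_fps) = 1"
    unfolding u_w_s_def by (rule inverse_mult_eq_1)
  \<comment> \<open>\<open>s C = C - 2 x C^2 = C - 2 (C - 1)\<close>.\<close>
  moreover have "s * catalan_fps = 2 - catalan_fps"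
    using catalan_fps_quadratic s(1) by algebra
  ultimately have wsC: "w * s * catalan_fps = 1" by (simp add: mult.assoc)
  \<comment> \<open>Since \<open>u = x C^2\<close> and \<open>w s C = 1\<close>, the product
    \<open>u w s\<close> is \<open>x C\<close>.\<close>
  have "u ^ 3 * w ^ 3 * s ^ 3 = fps_X ^ 3 * catalan_fps ^ 3 * (w * s * catalan_fps) ^ 3"
    by (simp add: u power_mult_distrib power2_eq_square mult_ac)
  then have "fps_X ^ 3 * catalan_fps ^ 3 = u ^ 3 * w ^ 3 * s ^ 3"
    by (simp add: wsC)
  then have "fps_X ^ 3 * catalan_fps ^ 3 / s ^ 3 = u ^ 3 * w ^ 3"
    using nz[of 3] by simp
  moreover have "Abs_fps (\<lambda>n. of_nat (total_occ [2, 1, 3] (Av n [1, 2, 3]))) = u ^ 3 * w ^ 3"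
    using gained_gf[of 0] by (intro fps_ext) (simp add: total_occ_Av u_w_s_def binomial_eq_0 del: One_nat_def)
  moreover have "fps_X ^ 3 * catalan_fps ^ 3 / s ^ 3
      = (fps_X - 1) / (2 * s ^ 2) - (3 * fps_X - 1) / (2 * s ^ 3)"
  proof -
    \<comment> \<open>Multiplying by \<open>h = 1/2\<close> and \<open>v = 1/s\<close> replaces the
      divisions by ring arithmetic.\<close>
    define h v where "h = fps_const (1 / 2 :: rat)" "v = inverse s"
    have h: "2 * h = 1" by (simp add: h_v_def numeral_fps_const)
    have v: "v * s = 1" using sv by (simp add: h_v_def)
    have div: "a / (2 * s ^ k) = a * h * v ^ k" for a k
    proof -
      have "a * h * v ^ k * (2 * s ^ k) = a * (2 * h) * (v * s) ^ k"
        by (simp only: power_mult_distrib mult_ac)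
      then have "a = a * h * v ^ k * (2 * s ^ k)"
        by (simp only: h v power_one mult_1_right)
      moreover have "2 * s ^ k \<noteq> 0" using nz by simp
      ultimately show ?thesis by (metis nonzero_mult_div_cancel_right)
    qed
    have "2 * (fps_X * catalan_fps) = 1 - s" by (simp add: s(1))
    then have "(2 * (fps_X * catalan_fps)) ^ 3 = (1 - s) ^ 3"
      by (rule arg_cong)
    then have "8 * (fps_X ^ 3 * catalan_fps ^ 3) = (1 - s) ^ 3"
      by (simp add: power_mult_distrib)
    \<comment> \<open>Expanding the cube and replacing \<open>s^2\<close> by \<open>1 - 4x\<close>
      leaves a polynomial linear in \<open>s\<close>; its two terms become the two fractions after
      division by \<open>s^3\<close>.\<close>
    also have "\<dots> = 4 * ((fps_X - 1) * s - (3 * fps_X - 1))"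
      using s(2) by algebra
    finally have "4 * (2 * (fps_X ^ 3 * catalan_fps ^ 3)) = 4 * ((fps_X - 1) * s - (3 * fps_X - 1))"
      by simp
    then have Y: "2 * (fps_X ^ 3 * catalan_fps ^ 3) = (fps_X - 1) * s - (3 * fps_X - 1)"
      by (simp only: mult_cancel_left) auto
    have "((fps_X - 1) * h * v ^ 2 - (3 * fps_X - 1) * h * v ^ 3) * s ^ 3
        = h * ((fps_X - 1) * s * (v * s) ^ 2 - (3 * fps_X - 1) * (v * s) ^ 3)"
      by (simp add: power_mult_distrib power2_eq_square power3_eq_cube algebra_simps)
    also have "\<dots> = h * (2 * (fps_X ^ 3 * catalan_fps ^ 3))"
      by (simp only: v Y power_one mult_1_right)
    also have "\<dots> = (2 * h) * (fps_X ^ 3 * catalan_fps ^ 3)"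
      by (simp only: mult_ac)
    finally have "fps_X ^ 3 * catalan_fps ^ 3
        = ((fps_X - 1) * h * v ^ 2 - (3 * fps_X - 1) * h * v ^ 3) * s ^ 3"
      by (simp only: h mult_1_left)
    then show ?thesis using nz[of 3] by (simp only: div nonzero_mult_div_cancel_right not_False_eq_True)
  qed
  ultimately show ?thesis
    unfolding one_minus_4X_powr_three_halves s(2)[symmetric] by (simp add: u_w_s_def)
qed

end
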